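(* For every integer $n\ge 7$, the $n$-dimensional spined cube $SQ_n$ contains two edge-disjoint Hamiltonian cycles.
   Context: All graphs are finite, simple and undirected. A cycle is Hamiltonian if it contains every vertex of the graph; two Hamiltonian cycles are edge-disjoint if they have no common edge. The spined cube $SQ_n$ ($n\ge 1$) has as vertices the $2^n$ binary strings $x_1x_2\cdots x_n$ and is defined recursively. $SQ_1$ is the complete graph on the two vertices $0$ and $1$. For $n\ge 2$, $SQ_n$ consists of two copies $0SQ_{n-1}$ and $1SQ_{n-1}$ of $SQ_{n-1}$ (every vertex label prefixed by $0$, respectively by $1$), together with the edges joining each vertex $x=0x_2\cdots x_n$ of $0SQ_{n-1}$ to exactly one vertex $x'$ of $1SQ_{n-1}$, where (all sums of bits are modulo 2): $x'=1x_2$ if $n=2$; $x'=1(x_2+x_n)x_3\cdots x_n$ if $n=3$ or $4$; $x'=1(x_2+x_{n-1})(x_3+x_n)x_4\cdots x_n$ if $n\ge 5$. *)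

theory Defs
  imports Main "HOL-Library.Z2"
begin

record 'a ugraph =
  verts :: "'a set"
  edges :: "'a set set"

definition simple_graph :: "'a ugraph \<Rightarrow> bool" where
  "simple_graph G \<longleftrightarrow> finite (verts G) \<and> (\<forall>e \<in> edges G. e \<subseteq> verts G \<and> card e = 2)"

text \<open>A cycle is given by the cyclic sequence of its vertices, without repeating the first one
  at the end.\<close>

definition cycle_edges :: "'a list \<Rightarrow> 'a set set" where
  "cycle_edges c = {{c ! i, c ! (Suc i mod length c)} | i. i < length c}"

definition is_cycle :: "'a ugraph \<Rightarrow> 'a list \<Rightarrow> bool" where
  "is_cycle G c \<longleftrightarrow>
    3 \<le> length c \<and> distinct c \<and> set c \<subseteq> verts G \<and> cycle_edges c \<subseteq> edges G"

definition hamiltonian_cycle :: "'a ugraph \<Rightarrow> 'a list \<Rightarrow> bool" where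
  "hamiltonian_cycle G c \<longleftrightarrow> is_cycle G c \<and> verts G \<subseteq> set c"

definition edge_disjoint :: "'a list \<Rightarrow> 'a list \<Rightarrow> bool" where
  "edge_disjoint c d \<longleftrightarrow> cycle_edges c \<inter> cycle_edges d = {}"

text \<open>A binary string \<open>x\<^sub>1 x\<^sub>2 \<dots> x\<^sub>n\<close> is a list over the two-element field, whose addition is
  addition modulo 2. List indices start at 0, so \<open>x\<^sub>i\<close> is \<open>x ! (i - 1)\<close>. The function below maps a
  vertex \<open>x = 0 x\<^sub>2 \<dots> x\<^sub>n\<close> to its partner \<open>x'\<close> (the first bit of its argument is ignored).\<close>

definition sq_partner :: "bit list \<Rightarrow> bit list" where
  "sq_partner x = (let n = length x in
     if n = 2 then [1, x ! 1]
     else if n = 3 \<or> n = 4 then 1 # (x ! 1 + x ! (n - 1)) # drop 2 x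
     else 1 # (x ! 1 + x ! (n - 2)) # (x ! 2 + x ! (n - 1)) # drop 3 x)"

text \<open>Dimension 0 is deliberately left unspecified.\<close>

fun spined_cube :: "nat \<Rightarrow> bit list ugraph" where
  "spined_cube (Suc 0) = \<lparr>verts = {[0], [1]}, edges = {{[0], [1]}}\<rparr>"
| "spined_cube (Suc (Suc n)) = (let G = spined_cube (Suc n) in
     \<lparr>verts = (#) 0 ` verts G \<union> (#) 1 ` verts G,
      edges = (`) ((#) 0) ` edges G \<union> (`) ((#) 1) ` edges G
        \<union> (\<lambda>x. {0 # x, sq_partner (0 # x)}) ` verts G\<rparr>)"

lemma verts_spined_cube: "1 \<le> n \<Longrightarrow> verts (spined_cube n) = {x. length x = n}"
proof (induction n rule: spined_cube.induct)
  case 1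
  then show ?case by (auto simp: length_Suc_conv)
next
  case (2 n)
  have "x \<in> (#) 0 ` {x. length x = Suc n} \<union> (#) 1 ` {x. length x = Suc n}
      \<longleftrightarrow> length x = Suc (Suc n)" for x :: "bit list"
  proof (cases x)
    case (Cons b y)
    then show ?thesis by (cases b) auto
  qed auto
  then have "(#) 0 ` {x. length x = Suc n} \<union> (#) 1 ` {x. length x = Suc n}
      = {x :: bit list. length x = Suc (Suc n)}" by blast
  then show ?case using 2 by (simp add: Let_def)
qed auto

lemma length_sq_partner: "2 \<le> length x \<Longrightarrow> length (sq_partner x) = length x"
  by (auto simp: sq_partner_def Let_def)

lemma hd_sq_partner: "hd (sq_partner x) = 1"
  by (auto simp: sq_partner_def Let_def)

lemma simple_graph_spined_cube: "1 \<le> n \<Longrightarrow> simple_graph (spined_cube n)"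
proof (induction n rule: spined_cube.induct)
  case 1
  then show ?case by (auto simp: simple_graph_def)
next
  case (2 n)
  let ?G = "spined_cube (Suc n)"
  have IH: "finite (verts ?G)" "\<And>e. e \<in> edges ?G \<Longrightarrow> e \<subseteq> verts ?G \<and> card e = 2"
    using 2 by (auto simp: simple_graph_def)
  have V: "verts ?G = {x. length x = Suc n}"
    "verts (spined_cube (Suc (Suc n))) = {x. length x = Suc (Suc n)}"
    by (rule verts_spined_cube; simp)+
  have "finite (verts (spined_cube (Suc (Suc n))))"
    using IH(1) by (simp add: Let_def)
  moreover have "e \<subseteq> verts (spined_cube (Suc (Suc n))) \<and> card e = 2"
    if "e \<in> edges (spined_cube (Suc (Suc n)))" for e
  proof -
    from that consider (copy) b e' where "e = (#) b ` e'" "e' \<in> edges ?G"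
      | (new) x where "e = {0 # x, sq_partner (0 # x)}" "x \<in> verts ?G"
      by (simp add: Let_def) blast
    then show ?thesis
    proof cases
      case copy
      then show ?thesis using IH(2)[OF copy(2)] unfolding V by (auto simp: card_image)
    next
      case new
      have "0 # x \<noteq> sq_partner (0 # x)" by (metis hd_sq_partner list.sel(1) zero_neq_one)
      then show ?thesis
        using new length_sq_partner[of "0 # x"] unfolding V by simp
    qed
  qed
  ultimately show ?case unfolding simple_graph_def by blast
qed simp

end

theory Submission
  imports Defs
begin

text \<open>
  Two edge-disjoint Hamiltonian cycles already exist in \<open>SQ\<^sub>4\<close>, which is 4-regular, so that the two
  cycles partition its edges; an induction then lifts such a pair from each dimension to the next.

  For \<open>n \<ge> 5\<close> the partner of a vertex \<open>0y\<close> arises from \<open>1y\<close> by adding the last two bits of \<open>y\<close> to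
  two others, so it is \<open>1y\<close> itself whenever \<open>y\<close> ends in 00. Suppose that a Hamiltonian
  cycle of \<open>SQ\<close> contains an edge \<open>uv\<close> whose ends both end in 00. Removing the copies of \<open>uv\<close> from
  the two copies of the cycle and joining the remaining paths by the edges from \<open>0u\<close> to \<open>1u\<close> and
  from \<open>0v\<close> to \<open>1v\<close> gives a Hamiltonian cycle in the next dimension (\<open>hamiltonian_cycle_double\<close>).
  The new edge from \<open>0u\<close> to \<open>1u\<close> again has both its ends ending in 00, so the construction can be
  iterated. Applied to two edge-disjoint cycles, with edges \<open>uv\<close> and \<open>wz\<close> that share no vertex, it
  yields edge-disjoint cycles (\<open>edge_disjoint_double\<close>), and the new special edges again share
  no vertex. The pair of cycles of \<open>SQ\<^sub>4\<close> in \<open>liftable_pair_4\<close> is chosen to have such edges \<open>uv\<close>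
  and \<open>wz\<close>.

  Writing every cycle as a list with first vertex \<open>u\<close> and last vertex \<open>v\<close> makes the special edge the
  closing one; the new cycle is then the copy of the list in \<open>0SQ\<close> followed by the reversed copy
  in \<open>1SQ\<close>.
\<close>

section \<open>Cycles as closed paths\<close>

fun path_edges :: "'a list \<Rightarrow> 'a set set" where
  "path_edges (x # y # zs) = insert {x, y} (path_edges (y # zs))"
| "path_edges _ = {}"

lemma path_edges_conv_nth: "path_edges c = {{c ! i, c ! Suc i} | i. Suc i < length c}"
proof (induction c rule: path_edges.induct)
  case (1 x y zs)
  have "{{(x # y # zs) ! i, (x # y # zs) ! Suc i} | i. Suc i < length (x # y # zs)}
      = insert {x, y} {{(y # zs) ! i, (y # zs) ! Suc i} | i. Suc i < length (y # zs)}"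
    (is "?L = ?R")
  proof
    show "?L \<subseteq> ?R"
    proof
      fix e assume "e \<in> ?L"
      then obtain i where "e = {(x # y # zs) ! i, (x # y # zs) ! Suc i}"
        "Suc i < length (x # y # zs)" by blast
      then show "e \<in> ?R" by (cases i) auto
    qed
    have "{x, y} \<in> ?L" by (auto intro!: exI[of _ 0])
    moreover have "{(y # zs) ! i, (y # zs) ! Suc i} \<in> ?L" if "Suc i < length (y # zs)" for i
      using that by (auto intro!: exI[of _ "Suc i"])
    ultimately show "?R \<subseteq> ?L" by blast
  qed
  with 1 show ?case by simp
qed auto

lemma cycle_edges_conv_path_edges:
  assumes "c \<noteq> []"
  shows "cycle_edges c = insert {hd c, last c} (path_edges c)"
proof -
  obtain m where m: "length c = Suc m" using assms by (cases c) auto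
  have "cycle_edges c = (\<lambda>i. {c ! i, c ! (Suc i mod length c)}) ` {..<Suc m}"
    unfolding cycle_edges_def m by auto
  also have "\<dots> = insert {c ! m, c ! 0} ((\<lambda>i. {c ! i, c ! Suc i}) ` {..<m})"
    unfolding lessThan_Suc m by auto
  also have "(\<lambda>i. {c ! i, c ! Suc i}) ` {..<m} = path_edges c"
    unfolding path_edges_conv_nth m by auto
  also have "{c ! m, c ! 0} = {hd c, last c}"
    using assms m by (auto simp: hd_conv_nth last_conv_nth)
  finally show ?thesis .
qed

lemma path_edges_append:
  assumes "xs \<noteq> []" "ys \<noteq> []"
  shows "path_edges (xs @ ys) = insert {last xs, hd ys} (path_edges xs \<union> path_edges ys)"
  using assms(1)
proof (induction xs rule: path_edges.induct)
  case ("2_2" x)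
  with assms(2) show ?case by (cases ys) auto
qed auto

lemma path_edges_rev: "path_edges (rev c) = path_edges c"
proof (induction c rule: path_edges.induct)
  case (1 x y zs)
  then show ?case
    by (simp add: path_edges_append[of "rev zs @ [y]" "[x]", simplified] insert_commute)
qed auto

lemma path_edges_map: "path_edges (map f c) = (`) f ` path_edges c"
  by (induction c rule: path_edges.induct) auto

section \<open>Doubling a Hamiltonian cycle\<close>

definition double :: "bit list list \<Rightarrow> bit list list" where
  "double c = map ((#) 0) c @ rev (map ((#) 1) c)"

lemma cycle_edges_double:
  assumes "c \<noteq> []"
  shows "cycle_edges (double c) =
    (`) ((#) 0) ` path_edges c \<union> (`) ((#) 1) ` path_edges c
      \<union> {{0 # hd c, 1 # hd c}, {0 # last c, 1 # last c}}"
  using assms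
  by (simp add: double_def cycle_edges_conv_path_edges path_edges_append path_edges_rev
      path_edges_map hd_map last_map last_rev hd_rev Un_commute insert_commute)

definition ends_in_00 :: "bit list \<Rightarrow> bool" where
  "ends_in_00 x \<longleftrightarrow> x ! (length x - 2) = 0 \<and> x ! (length x - 1) = 0"

lemma ends_in_00_Cons: "2 \<le> length x \<Longrightarrow> ends_in_00 (b # x) \<longleftrightarrow> ends_in_00 x"
  by (auto simp: ends_in_00_def nth_Cons' diff_diff_left numeral_2_eq_2)

lemma sq_partner_ends_in_00:
  assumes "ends_in_00 x" "4 \<le> length x"
  shows "sq_partner (0 # x) = 1 # x"
proof -
  obtain a b y where x: "x = a # b # y" and y: "2 \<le> length y"
    using assms(2) by (cases x; cases "tl x") auto
  then show ?thesis using assms(1)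
    by (cases y; cases "tl y")
      (auto simp: sq_partner_def ends_in_00_def Let_def nth_Cons' diff_diff_left)
qed

text \<open>The closing edge of \<open>c\<close> is the one that is dropped from both copies; the conditions on its two
  ends ensure that the joining edges belong to the spined cube.\<close>

lemma hamiltonian_cycle_double:
  assumes c: "hamiltonian_cycle (spined_cube n) c" and n: "4 \<le> n"
    and "ends_in_00 (hd c)" "ends_in_00 (last c)"
  shows "hamiltonian_cycle (spined_cube (Suc n)) (double c)"
proof -
  have ne: "c \<noteq> []" and dist: "distinct c" and len: "3 \<le> length c"
    and set: "set c = verts (spined_cube n)" and edges: "cycle_edges c \<subseteq> edges (spined_cube n)"
    using c by (auto simp: hamiltonian_cycle_def is_cycle_def)
  obtain m where m: "n = Suc m" using n by (cases n) auto
  have vertex: "x \<in> set c \<longleftrightarrow> length x = n" for x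
    using set n verts_spined_cube[of n] by simp
  have cross: "{0 # x, 1 # x} \<in> edges (spined_cube (Suc n))"
    if "x \<in> set c" "ends_in_00 x" for x
  proof -
    have "sq_partner (0 # x) = 1 # x"
      using that vertex n by (simp add: sq_partner_ends_in_00)
    then show ?thesis
      using that(1) unfolding set m by (auto simp: Let_def intro!: image_eqI[where x = x])
  qed
  have copies: "(`) ((#) b) ` path_edges c \<subseteq> edges (spined_cube (Suc n))" for b
    using edges ne unfolding m by (cases b) (auto simp: Let_def cycle_edges_conv_path_edges)
  have "cycle_edges (double c) \<subseteq> edges (spined_cube (Suc n))"
    using copies[of 0] copies[of 1] cross[of "hd c"] cross[of "last c"] ne assms(3,4)
    by (simp add: cycle_edges_double)
  moreover have "distinct (double c)"
    using dist by (auto simp: double_def distinct_map)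
  moreover have "set (double c) = verts (spined_cube (Suc n))"
    unfolding m using set m by (simp add: double_def Let_def)
  ultimately show ?thesis
    using len by (simp add: hamiltonian_cycle_def is_cycle_def double_def)
qed

text \<open>Within each copy the edges come from the two given cycles. The joining edges could coincide
  only if the two cycles were opened at a common vertex.\<close>

lemma edge_disjoint_double:
  assumes "edge_disjoint c d" "c \<noteq> []" "d \<noteq> []"
    and ends: "{hd c, last c} \<inter> {hd d, last d} = {}"
  shows "edge_disjoint (double c) (double d)"
proof -
  have disj: "path_edges c \<inter> path_edges d = {}"
    using assms by (auto simp: edge_disjoint_def cycle_edges_conv_path_edges)
  have inj: "inj ((`) ((#) b))" for b :: bit by (simp add: inj_def inj_image_eq_iff)
  have nonempty: "e \<noteq> {}" if "e \<in> path_edges a" for e and a :: "bit list list"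
    using that by (induction a rule: path_edges.induct) auto
  have copies: "(`) ((#) b) ` path_edges c \<inter> (`) ((#) b') ` path_edges d = {}" for b b'
  proof (cases "b = b'")
    case True
    then show ?thesis using disj inj[of b] by (simp flip: image_Int)
  next
    case False
    have "(#) b ` e \<noteq> (#) b' ` e'" if e: "e \<in> path_edges c" for e e'
    proof -
      obtain x where "x \<in> e" using nonempty[OF e] by blast
      then have "b # x \<in> (#) b ` e" "b # x \<notin> (#) b' ` e'" using False by auto
      then show ?thesis by metis
    qed
    then show ?thesis by blast
  qed
  have no_cross: "{0 # x, 1 # x} \<noteq> (#) b ` e" for x e and b :: bit
  proof
    assume eq: "{0 # x, 1 # x} = (#) b ` e"
    have "0 # x \<in> (#) b ` e" "1 # x \<in> (#) b ` e" unfolding eq[symmetric] by auto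
    then show False by auto
  qed
  show ?thesis
    unfolding edge_disjoint_def using assms(2,3) copies ends no_cross
    by (auto simp: cycle_edges_double doubleton_eq_iff disjoint_iff)
qed

section \<open>The induction\<close>

definition liftable_pair :: "nat \<Rightarrow> bit list list \<Rightarrow> bit list list \<Rightarrow> bool" where
  "liftable_pair n c d \<longleftrightarrow>
    hamiltonian_cycle (spined_cube n) c \<and> hamiltonian_cycle (spined_cube n) d \<and> edge_disjoint c d
      \<and> (\<forall>x \<in> {hd c, last c, hd d, last d}. ends_in_00 x)
      \<and> {hd c, last c} \<inter> {hd d, last d} = {}"

text \<open>The four vertices of \<open>SQ\<^sub>4\<close> ending in 00 form a 4-cycle, and the two closing edges, from 1000 to
  0000 and from 1100 to 0100, are opposite edges of it. With these prescribed, the two cycles come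
  from a backtracking search.\<close>

lemma liftable_pair_4:
  "liftable_pair 4
    [[0,0,0,0], [0,0,0,1], [0,0,1,1], [0,0,1,0],
     [0,1,1,0], [0,1,0,0], [0,1,0,1], [0,1,1,1],
     [1,0,1,1], [1,0,0,1], [1,1,1,1], [1,1,0,1],
     [1,1,0,0], [1,1,1,0], [1,0,1,0], [1,0,0,0]]
    [[0,1,0,0], [0,0,0,0], [0,0,1,0], [1,0,1,0],
     [1,0,1,1], [1,1,0,1], [0,0,0,1], [0,1,1,1],
     [0,1,1,0], [1,1,1,0], [1,1,1,1], [0,0,1,1],
     [0,1,0,1], [1,0,0,1], [1,0,0,0], [1,1,0,0]]"
  (is "liftable_pair 4 ?c ?d")
proof -
  have four: "4 = Suc (Suc (Suc (Suc 0)))" by simp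
  have len: "3 \<le> length ?c" "3 \<le> length ?d" by simp_all
  have dist: "distinct ?c" "distinct ?d" by simp_all
  have verts: "verts (spined_cube 4) = set ?c" "verts (spined_cube 4) = set ?d"
    by (auto simp: four Let_def)
  have edges: "cycle_edges ?c \<subseteq> edges (spined_cube 4)" "cycle_edges ?d \<subseteq> edges (spined_cube 4)"
    by (simp_all add: four Let_def cycle_edges_conv_path_edges doubleton_eq_iff sq_partner_def)
  have "edge_disjoint ?c ?d"
    by (simp add: edge_disjoint_def cycle_edges_conv_path_edges doubleton_eq_iff)
  with len dist verts edges show ?thesis
    by (simp add: liftable_pair_def hamiltonian_cycle_def is_cycle_def ends_in_00_def)
qed

lemma liftable_pair_double:
  assumes "liftable_pair n c d" "4 \<le> n"
  shows "liftable_pair (Suc n) (double c) (double d)"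
proof -
  have ne: "c \<noteq> []" "d \<noteq> []"
    using assms(1) by (auto simp: liftable_pair_def hamiltonian_cycle_def is_cycle_def)
  have "length x = n" if "x \<in> set c \<union> set d" for x
    using that assms verts_spined_cube[of n]
    by (auto simp: liftable_pair_def hamiltonian_cycle_def is_cycle_def)
  then have len: "2 \<le> length (hd c)" "2 \<le> length (hd d)"
    using ne assms(2) by simp_all
  \<comment> \<open>The closing edge of the doubled cycle is the joining edge at the first vertex of the old one.\<close>
  have ends: "hd (double a) = 0 # hd a" "last (double a) = 1 # hd a" if "a \<noteq> []" for a
    using that by (simp_all add: double_def hd_map last_rev)
  show ?thesis
    using assms ne len
    by (auto simp: liftable_pair_def ends ends_in_00_Cons
        intro!: hamiltonian_cycle_double edge_disjoint_double)
qed

theorem theorem4p3: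
  fixes n :: nat
  assumes "7 \<le> n"
  shows "\<exists>c d. hamiltonian_cycle (spined_cube n) c \<and> hamiltonian_cycle (spined_cube n) d
           \<and> edge_disjoint c d"
proof -
  have "4 \<le> n" using assms by simp
  then have "\<exists>c d. liftable_pair n c d"
    by (induction n rule: dec_induct) (blast intro: liftable_pair_4 liftable_pair_double)+
  then show ?thesis by (auto simp: liftable_pair_def)
qed

end
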